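(* $\chi_{la}(C_4\times P_2)=\chi_{la}((C_4\times P_2)+e)=4$, where $(C_4\times P_2)+e$ is the graph obtained from $C_4\times P_2$ by adding an extra edge $e$ whose end vertices lie in different parts of the bipartition of $C_4\times P_2$.
   Context: $C_4\times P_2$ is the Cartesian product of a 4-cycle and a path on 2 vertices (the cube graph), a bipartite graph. For a simple graph $G=(V,E)$ with $q$ edges, a bijection $f:E\to\{1,\dots,q\}$ is a local antimagic labeling if $f^+(u)\neq f^+(v)$ for every edge $uv$, where $f^+(u)=\sum_{e\ni u} f(e)$. The local antimagic chromatic number $\chi_{la}(G)$ is the minimum number of distinct values of $f^+$ over all local antimagic labelings $f$ of $G$. *)

theory Defs
  imports Main
begin

type_synonym 'a graph = "'a set \<times> 'a set set"

abbreviation verts :: "'a graph \<Rightarrow> 'a set" where "verts G \<equiv> fst G"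
abbreviation edges :: "'a graph \<Rightarrow> 'a set set" where "edges G \<equiv> snd G"

definition simple_graph :: "'a graph \<Rightarrow> bool" where
  "simple_graph G \<longleftrightarrow> finite (verts G) \<and> (\<forall>e\<in>edges G. e \<subseteq> verts G \<and> card e = 2)"

definition path_graph :: "nat \<Rightarrow> nat graph" where
  "path_graph n = ({..<n}, {{i, Suc i} | i. Suc i < n})"

text \<open>A simple graph only for \<open>n \<ge> 3\<close>.\<close>
definition cycle_graph :: "nat \<Rightarrow> nat graph" where
  "cycle_graph n = ({..<n}, {{i, Suc i mod n} | i. i < n})"

definition cartesian_product :: "'a graph \<Rightarrow> 'b graph \<Rightarrow> ('a \<times> 'b) graph" where
  "cartesian_product G H =
     (verts G \<times> verts H,
      {{(u, x), (v, x)} | u v x. {u, v} \<in> edges G \<and> x \<in> verts H} \<union>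
      {{(u, x), (u, y)} | u x y. u \<in> verts G \<and> {x, y} \<in> edges H})"

definition add_edge :: "'a graph \<Rightarrow> 'a set \<Rightarrow> 'a graph" where
  "add_edge G e = (verts G, insert e (edges G))"

definition bipartition :: "'a graph \<Rightarrow> 'a set \<Rightarrow> 'a set \<Rightarrow> bool" where
  "bipartition G A B \<longleftrightarrow> A \<union> B = verts G \<and> A \<inter> B = {} \<and>
     (\<forall>e\<in>edges G. \<exists>a\<in>A. \<exists>b\<in>B. e = {a, b})"

definition vertex_sum :: "'a graph \<Rightarrow> ('a set \<Rightarrow> nat) \<Rightarrow> 'a \<Rightarrow> nat" where
  "vertex_sum G f u = (\<Sum>e\<in>{e \<in> edges G. u \<in> e}. f e)"

definition local_antimagic :: "'a graph \<Rightarrow> ('a set \<Rightarrow> nat) \<Rightarrow> bool" where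
  "local_antimagic G f \<longleftrightarrow>
     bij_betw f (edges G) {1..card (edges G)} \<and>
     (\<forall>u v. {u, v} \<in> edges G \<longrightarrow> vertex_sum G f u \<noteq> vertex_sum G f v)"

text \<open>The infimum is \<open>0\<close> if \<open>G\<close> has no local antimagic labeling; a positive value is an
  attained minimum.\<close>
definition chi_la :: "'a graph \<Rightarrow> nat" where
  "chi_la G = Inf {card (vertex_sum G f ` verts G) | f. local_antimagic G f}"

lemma simple_graph_C4_P2: "simple_graph (cartesian_product (cycle_graph 4) (path_graph 2))"
proof -
  have *: "Suc i mod 4 \<noteq> i" "i \<noteq> Suc i mod 4" if "i < 4" for i :: nat
    using that by presburger+
  show ?thesis
    unfolding simple_graph_def cartesian_product_def cycle_graph_def path_graph_def
    using * by (auto simp: card_insert_if doubleton_eq_iff)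
qed

lemma edges_C4_P2:
  "edges (cartesian_product (cycle_graph 4) (path_graph 2)) =
    {{(0,0), (1,0)}, {(1,0), (2,0)}, {(2,0), (3,0)}, {(3,0), (0,0)},
     {(0,1), (1,1)}, {(1,1), (2,1)}, {(2,1), (3,1)}, {(3,1), (0,1)},
     {(0,0), (0,1)}, {(1,0), (1,1)}, {(2,0), (2,1)}, {(3,0), (3,1)}}"
proof -
  have c: "snd (cycle_graph 4) = {{0,1},{1,2},{2,3},{3,0}}"
  proof -
    have "snd (cycle_graph 4) = (\<lambda>i. {i, Suc i mod 4}) ` {..<4}"
      by (auto simp: cycle_graph_def)
    also have "{..<4} = {0,1,2,3::nat}" by auto
    finally have "snd (cycle_graph 4) = (\<lambda>i. {i, Suc i mod 4}) ` {0,1,2,3}" .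
    moreover have "Suc 0 mod 4 = 1" "Suc 1 mod 4 = 2" "Suc 2 mod 4 = 3" "Suc 3 mod 4 = 0"
      by simp_all
    ultimately show ?thesis by (simp only: image_insert image_empty)
  qed
  have p: "snd (path_graph 2) = {{0,1}}"
    by (auto simp: path_graph_def)
  have v: "fst (cycle_graph 4) = {0,1,2,3}" "fst (path_graph 2) = {0,1}"
    by (auto simp: cycle_graph_def path_graph_def)
  have c': "\<exists>u v. e = {u, v}" if "e \<in> snd (cycle_graph 4)" for e
    using that by (auto simp: cycle_graph_def)
  have p': "\<exists>u v. e = {u, v}" if "e \<in> snd (path_graph 2)" for e
    using that by (auto simp: path_graph_def)
  have 1: "{{(u, x), (v, x)} | u v x. {u, v} \<in> snd (cycle_graph 4) \<and> x \<in> fst (path_graph 2)} =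
    (\<Union>x\<in>fst (path_graph 2). (\<lambda>e. (\<lambda>u. (u, x)) ` e) ` snd (cycle_graph 4))"
    (is "?L = ?R")
  proof (intro equalityI subsetI)
    fix z assume "z \<in> ?L"
    then obtain u v x where *: "z = {(u, x), (v, x)}" "{u, v} \<in> snd (cycle_graph 4)"
      "x \<in> fst (path_graph 2)" by blast
    have "z = (\<lambda>u. (u, x)) ` {u, v}" using * by simp
    with * show "z \<in> ?R" by blast
  next
    fix z assume "z \<in> ?R"
    then obtain e x where *: "z = (\<lambda>u. (u, x)) ` e" "e \<in> snd (cycle_graph 4)"
      "x \<in> fst (path_graph 2)" by blast
    with c' obtain u v where "e = {u, v}" by blast
    with * have "z = {(u, x), (v, x)}" "{u, v} \<in> snd (cycle_graph 4)" by simp_all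
    with * show "z \<in> ?L" by blast
  qed
  have 2: "{{(u, x), (u, y)} | u x y. u \<in> fst (cycle_graph 4) \<and> {x, y} \<in> snd (path_graph 2)} =
    (\<Union>u\<in>fst (cycle_graph 4). (\<lambda>e. Pair u ` e) ` snd (path_graph 2))"
    (is "?L = ?R")
  proof (intro equalityI subsetI)
    fix z assume "z \<in> ?L"
    then obtain u x y where *: "z = {(u, x), (u, y)}" "{x, y} \<in> snd (path_graph 2)"
      "u \<in> fst (cycle_graph 4)" by blast
    have "z = Pair u ` {x, y}" using * by simp
    with * show "z \<in> ?R" by blast
  next
    fix z assume "z \<in> ?R"
    then obtain e u where *: "z = Pair u ` e" "e \<in> snd (path_graph 2)"
      "u \<in> fst (cycle_graph 4)" by blast
    with p' obtain x y where "e = {x, y}" by blast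
    with * have "z = {(u, x), (u, y)}" "{x, y} \<in> snd (path_graph 2)" by simp_all
    with * show "z \<in> ?L" by blast
  qed
  show ?thesis
    unfolding cartesian_product_def snd_conv 1 2 unfolding c p v
    by (simp only: image_insert image_empty Union_insert Union_empty
        Un_insert_left Un_empty_left Un_empty_right)
qed

lemma bipartition_C4_P2:
  "bipartition (cartesian_product (cycle_graph 4) (path_graph 2))
     {(0,0), (2,0), (1,1), (3,1)} {(1,0), (3,0), (0,1), (2,1)}"
proof -
  have "fst (cartesian_product (cycle_graph 4) (path_graph 2)) = {0,1,2,3} \<times> {0,1}"
    by (auto simp: cartesian_product_def cycle_graph_def path_graph_def)
  then show ?thesis
    unfolding bipartition_def edges_C4_P2 by (auto simp: doubleton_eq_iff)
qed

lemma non_edge_C4_P2: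
  "{(0,0), (2,1)} \<notin> edges (cartesian_product (cycle_graph 4) (path_graph 2))"
  unfolding edges_C4_P2 by (simp add: doubleton_eq_iff)

end

theory Submission
  imports Defs
begin

text \<open>
  \<^emph>\<open>Lower bound.\<close> Every edge of a bipartite graph meets each part once, so the vertex sums over
  either part add up to the sum \<open>T\<close> of all labels; here \<open>T\<close> is \<open>78\<close> or \<open>91\<close>, not a multiple
  of \<open>4\<close>, so each part carries at least two colours. If there were only three colours, some
  colour \<open>v\<close> would occur in both parts. In the cube a vertex is adjacent to the whole opposite
  part except its antipode, so \<open>v\<close> occurs exactly on one antipodal pair, and the remaining two
  colours \<open>p\<close>, \<open>q\<close> each fill the rest of one part. Then \<open>v + 3 p = T = v + 3 q\<close>, so \<open>p = q\<close>,
  which is absurd. The extra edge can only join antipodes and does not affect the argument.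

  \<^emph>\<open>Upper bound.\<close> A labeling is an ordering of the edges; two orderings with four colours were
  found by computer search, and rotating the 4-cycle moves the extra edge to any antipodal pair.
\<close>

section \<open>Lower bound from double counting in bipartite graphs\<close>

lemma bipartition_disjoint: "bipartition G X Y \<Longrightarrow> X \<inter> Y = {}"
  by (simp add: bipartition_def)

lemma bipartition_edgeE:
  assumes "bipartition G X Y" "e \<in> edges G"
  obtains a b where "a \<in> X" "b \<in> Y" "e = {a, b}"
proof -
  have "\<forall>e\<in>edges G. \<exists>a\<in>X. \<exists>b\<in>Y. e = {a, b}"
    using assms(1) unfolding bipartition_def by (elim conjE)
  from bspec[OF this assms(2)] show thesis
    by (elim bexE) (rule that)
qed

lemma bipartition_swap:
  assumes "bipartition G X Y"
  shows "bipartition G Y X"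
proof -
  have "\<exists>b\<in>Y. \<exists>a\<in>X. e = {b, a}" if "e \<in> edges G" for e
  proof -
    from assms that obtain a b where "a \<in> X" "b \<in> Y" "e = {a, b}"
      by (rule bipartition_edgeE)
    then show ?thesis
      by (intro bexI[of _ b] bexI[of _ a]) auto
  qed
  then show ?thesis
    using assms by (simp add: bipartition_def Un_commute Int_commute)
qed

lemma bipartition_add_edge:
  assumes "bipartition G X Y" "a \<in> X" "b \<in> Y" "e = {a, b}"
  shows "bipartition (add_edge G e) X Y"
proof -
  have "\<exists>a\<in>X. \<exists>b\<in>Y. e' = {a, b}" if "e' \<in> insert e (edges G)" for e'
  proof (cases "e' = e")
    case True
    then show ?thesis
      using assms by (intro bexI[of _ a] bexI[of _ b]) auto
  next
    case False
    then show ?thesis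
      using that by (elim insertE) (simp, meson bipartition_edgeE[OF assms(1)])
  qed
  then show ?thesis
    using assms(1) by (simp add: bipartition_def add_edge_def)
qed

lemma sum_vertex_sum_part:
  assumes "bipartition G X Y" "finite (edges G)" "finite X"
  shows "sum (vertex_sum G f) X = sum f (edges G)"
proof -
  have "sum (vertex_sum G f) X = (\<Sum>u\<in>X. \<Sum>e\<in>edges G. if u \<in> e then f e else 0)"
    unfolding vertex_sum_def using assms(2) by (simp add: sum.inter_filter)
  also have "\<dots> = (\<Sum>e\<in>edges G. \<Sum>u\<in>X. if u \<in> e then f e else 0)"
    by (rule sum.swap)
  also have "\<dots> = sum f (edges G)"
  proof (rule sum.cong[OF refl])
    fix e assume "e \<in> edges G"
    with assms(1) obtain a b where ab: "a \<in> X" "b \<in> Y" "e = {a, b}"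
      by (rule bipartition_edgeE)
    then have "b \<notin> X"
      using bipartition_disjoint[OF assms(1)] by blast
    then have "{u \<in> X. u \<in> e} = {a}"
      using ab by auto
    then show "(\<Sum>u\<in>X. if u \<in> e then f e else 0) = f e"
      using sum.inter_filter[OF assms(3), of "\<lambda>_. f e" "\<lambda>u. u \<in> e"] by simp
  qed
  finally show ?thesis .
qed

text \<open>The bound \<open>card I \<ge> 4\<close> is sharp: for three indices, colouring both endpoints of each matched
  pair alike uses only three colours.\<close>

lemma crown_colours_ge_4:
  fixes x y :: "'i \<Rightarrow> nat"
  assumes card: "card I \<ge> 4"
    and crown: "\<And>i j. i \<in> I \<Longrightarrow> j \<in> I \<Longrightarrow> i \<noteq> j \<Longrightarrow> x i \<noteq> y j"
    and sums: "sum x I = sum y I"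
    and ndvd: "\<not> card I dvd sum x I"
  shows "card (x ` I \<union> y ` I) \<ge> 4"
proof (rule ccontr)
  define C where "C = x ` I \<union> y ` I"
  assume "\<not> 4 \<le> card (x ` I \<union> y ` I)"
  then have C3: "card C \<le> 3"
    by (simp add: C_def)
  have fin: "finite I"
    using card by (auto intro: card_ge_0_finite)
  have finC: "finite C"
    using fin by (simp add: C_def)
  \<comment> \<open>A function with a single value \<open>c\<close> has sum
    \<open>card I * c\<close>, a multiple of \<open>card I\<close>.\<close>
  have two: "card (g ` I) \<ge> 2" if "\<not> card I dvd sum g I" for g :: "'i \<Rightarrow> nat"
  proof (rule ccontr)
    assume "\<not> 2 \<le> card (g ` I)"
    then have "card (g ` I) \<le> Suc 0" by simp
    then have const: "g i = g j" if "i \<in> I" "j \<in> I" for i j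
      using card_le_Suc0_iff_eq[OF finite_imageI[OF fin], of g] that by blast
    obtain c where "\<And>i. i \<in> I \<Longrightarrow> g i = c"
      using const by blast
    then have "sum g I = card I * c" by simp
    with that show False by simp
  qed
  have "x ` I \<inter> y ` I \<noteq> {}"
  proof
    assume "x ` I \<inter> y ` I = {}"
    then have "card C = card (x ` I) + card (y ` I)"
      unfolding C_def using fin by (simp add: card_Un_disjoint)
    then show False
      using C3 two[of x] two[of y] ndvd sums by simp
  qed
  then obtain i j where ij: "i \<in> I" "j \<in> I" "x i = y j"
    by blast
  then have shared: "x i = y i" "i \<in> I"
    using crown[of i j] by auto
  define J where "J = I - {i}"
  have J: "finite J" "card J \<ge> 3" "card J + 1 = card I"
    using fin card shared(2) by (auto simp: J_def)
  define D where "D = C - {x i}"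
  have D: "x k \<in> D" "y k \<in> D" if "k \<in> J" for k
    using that crown[of k i] crown[of i k] shared by (auto simp: D_def C_def J_def)
  have D2: "card D \<le> 2" "finite D"
    using C3 finC shared by (auto simp: D_def C_def)
  \<comment> \<open>Here \<open>card I \<ge> 4\<close> enters: three indices besides
    \<open>i\<close>, so that any index of \<open>J\<close> differs from \<open>k\<close> or from
    \<open>l\<close>.\<close>
  obtain S where "S \<subseteq> J" "card S = 3"
    using obtain_subset_with_card_n[OF J(2)] by blast
  then obtain j k l where jkl: "j \<in> J" "k \<in> J" "l \<in> J" "j \<noteq> k" "j \<noteq> l" "k \<noteq> l"
    by (auto simp: card_3_iff)
  have crownJ: "x m \<noteq> y n" if "m \<in> J" "n \<in> J" "m \<noteq> n" for m n
    using that crown by (auto simp: J_def)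
  define p q where "p = x j" and "q = y k"
  have pq: "p \<noteq> q"
    using crownJ jkl by (simp add: p_def q_def)
  have "{p, q} \<subseteq> D" "card {p, q} = 2"
    using D jkl pq by (auto simp: p_def q_def)
  then have Dpq: "D = {p, q}"
    using D2 by (intro card_seteq[symmetric]) auto
  have yq: "y m = q" if "m \<in> J" "m \<noteq> j" for m
    using D(2)[OF that(1)] crownJ[OF jkl(1) that(1)] that(2) Dpq by (auto simp: p_def)
  \<comment> \<open>One of \<open>k\<close>, \<open>l\<close> differs from \<open>m\<close>, and
    \<open>y\<close> takes the value \<open>q\<close> there, which leaves only \<open>p\<close> for
    \<open>x m\<close>.\<close>
  have xp: "x m = p" if "m \<in> J" for m
    using D(1)[OF that] crownJ[OF that, of k] crownJ[OF that, of l] yq[of k] yq[of l] jkl Dpq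
    by auto
  \<comment> \<open>Only \<open>m = j\<close> is new: \<open>x k = p\<close> with
    \<open>k \<noteq> j\<close> rules out \<open>p\<close>.\<close>
  have yq': "y m = q" if "m \<in> J" for m
    using that yq[of m] D(2)[of m] crownJ[of k m] xp[of k] jkl Dpq by (cases "m = j") auto
  have "sum x I = x i + card J * p" "sum y I = x i + card J * q"
    using fin shared xp yq' by (simp_all add: sum.remove[of I i] J_def)
  then show False
    using sums pq J(2) by auto
qed

text \<open>The graph contains a crown, a complete bipartite graph minus the perfect matching
  \<open>\<sigma>\<close>. Pulling the sums on \<open>Y\<close> back along \<open>\<sigma>\<close>
  gives two functions on \<open>X\<close>. Matched vertices may be adjacent or not, which admits
  extra edges.\<close>

lemma local_antimagic_colours_ge_4:
  assumes bip: "bipartition G X Y" and fin: "finite (edges G)"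
    and \<sigma>: "bij_betw \<sigma> X Y"
    and card: "card X \<ge> 4"
    and crown: "\<And>a b. a \<in> X \<Longrightarrow> b \<in> X \<Longrightarrow> a \<noteq> b \<Longrightarrow> {a, \<sigma> b} \<in> edges G"
    and f: "local_antimagic G f"
    and ndvd: "\<not> card X dvd \<Sum>{1..card (edges G)}"
  shows "card (vertex_sum G f ` verts G) \<ge> 4"
proof -
  have finX: "finite X" and finY: "finite Y"
    using card bij_betw_finite[OF \<sigma>] card_ge_0_finite[of X] by auto
  have Y: "\<sigma> ` X = Y"
    using \<sigma> by (simp add: bij_betw_def)
  have "bij_betw f (edges G) {1..card (edges G)}"
    using f by (simp add: local_antimagic_def)
  then have total: "sum f (edges G) = \<Sum>{1..card (edges G)}"
    using sum.reindex_bij_betw[of f _ _ "\<lambda>i. i"] by fastforce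
  have sumX: "sum (vertex_sum G f) X = sum f (edges G)"
    using sum_vertex_sum_part[OF bip fin finX] .
  have sumY: "sum (\<lambda>a. vertex_sum G f (\<sigma> a)) X = sum f (edges G)"
    using sum_vertex_sum_part[OF bipartition_swap[OF bip] fin finY]
      sum.reindex_bij_betw[OF \<sigma>, of "vertex_sum G f"] by simp
  have "card (vertex_sum G f ` X \<union> (\<lambda>a. vertex_sum G f (\<sigma> a)) ` X) \<ge> 4"
  proof (rule crown_colours_ge_4[OF card])
    show "vertex_sum G f a \<noteq> vertex_sum G f (\<sigma> b)" if "a \<in> X" "b \<in> X" "a \<noteq> b" for a b
      using crown[OF that] f by (simp add: local_antimagic_def)
    show "sum (vertex_sum G f) X = sum (\<lambda>a. vertex_sum G f (\<sigma> a)) X"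
      using sumX sumY by simp
    show "\<not> card X dvd sum (vertex_sum G f) X"
      unfolding sumX total by (rule ndvd)
  qed
  moreover have "vertex_sum G f ` X \<union> (\<lambda>a. vertex_sum G f (\<sigma> a)) ` X = vertex_sum G f ` verts G"
    using bip Y by (auto simp: bipartition_def)
  ultimately show ?thesis by simp
qed

section \<open>Labelings given by edge orderings\<close>

definition order_label :: "'a list \<Rightarrow> 'a \<Rightarrow> nat" where
  "order_label es e = the (map_of (zip es [1..<Suc (length es)]) e)"

lemma order_label_nth:
  assumes "distinct es" "i < length es"
  shows "order_label es (es ! i) = Suc i"
  using assms unfolding order_label_def
  by (simp add: map_of_zip_nth del: upt_Suc)

lemma bij_betw_order_label:
  assumes "distinct es"
  shows "bij_betw (order_label es) (set es) {1..card (set es)}"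
proof -
  have "order_label es ` set es = Suc ` {..<length es}"
    using assms by (force simp: set_conv_nth order_label_nth image_iff)
  also have "\<dots> = {1..card (set es)}"
    using assms by (simp add: distinct_card lessThan_atLeast0 atLeastLessThanSuc_atLeastAtMost)
  finally show ?thesis
    \<comment> \<open>Injectivity by counting: the image is as large as the domain.\<close>
    by (simp add: bij_betw_def eq_card_imp_inj_on)
qed

text \<open>Removes all label lookups, so that for a concrete list the simplifier can evaluate the
  sum.\<close>

lemma vertex_sum_order_label:
  assumes "distinct es" "edges G = set es"
  shows "vertex_sum G (order_label es) u =
    sum_list (map2 (\<lambda>e i. if u \<in> e then i else 0) es [1..<Suc (length es)])"
proof -
  have "vertex_sum G (order_label es) u = (\<Sum>e\<in>set es. if u \<in> e then order_label es e else 0)"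
    unfolding vertex_sum_def using assms(2) by (simp add: sum.inter_filter)
  also have "\<dots> = sum_list (map (\<lambda>e. if u \<in> e then order_label es e else 0) es)"
    using assms(1) by (simp add: sum_list_distinct_conv_sum_set)
  also have "map (\<lambda>e. if u \<in> e then order_label es e else 0) es =
      map2 (\<lambda>e i. if u \<in> e then i else 0) es [1..<Suc (length es)]"
    using assms(1) by (intro nth_equalityI) (auto simp: order_label_nth simp del: upt_Suc)
  finally show ?thesis .
qed

text \<open>The pairs \<open>ps\<close> orient each edge, so the condition on all \<open>u\<close>,
  \<open>v\<close> becomes a finite check; the reverse orientation follows by symmetry.\<close>

lemma local_antimagic_order_label:
  assumes "distinct es" "edges G = set es" "es = map (\<lambda>(u, v). {u, v}) ps"
    and "\<forall>(u, v)\<in>set ps. vertex_sum G (order_label es) u \<noteq> vertex_sum G (order_label es) v"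
  shows "local_antimagic G (order_label es)"
  unfolding local_antimagic_def
proof (intro conjI allI impI)
  show "bij_betw (order_label es) (edges G) {1..card (edges G)}"
    unfolding assms(2) by (rule bij_betw_order_label[OF assms(1)])
  fix u v assume "{u, v} \<in> edges G"
  then have "(u, v) \<in> set ps \<or> (v, u) \<in> set ps"
    using assms(2,3) by (auto simp: doubleton_eq_iff)
  then show "vertex_sum G (order_label es) u \<noteq> vertex_sum G (order_label es) v"
    using assms(4) by fastforce
qed

lemma chi_la_eqI:
  assumes "\<And>f. local_antimagic G f \<Longrightarrow> n \<le> card (vertex_sum G f ` verts G)"
    and "local_antimagic G f" "card (vertex_sum G f ` verts G) = n"
  shows "chi_la G = n"
  unfolding chi_la_def using assms by (intro cInf_eq_minimum) auto

section \<open>The cube and its diagonals\<close>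

abbreviation cube :: "(nat \<times> nat) graph" where
  "cube \<equiv> cartesian_product (cycle_graph 4) (path_graph 2)"

abbreviation (input) even_part :: "(nat \<times> nat) set" where
  "even_part \<equiv> {(0,0), (2,0), (1,1), (3,1)}"

abbreviation (input) odd_part :: "(nat \<times> nat) set" where
  "odd_part \<equiv> {(1,0), (3,0), (0,1), (2,1)}"

text \<open>The vertex at distance 3, the only one of the opposite part that is not a neighbour. On
  layers 0 and 1, \<open>1 - j\<close> is the swap.\<close>

definition antipode :: "nat \<times> nat \<Rightarrow> nat \<times> nat" where
  "antipode = (\<lambda>(k, j). ((k + 2) mod 4, 1 - j))"

lemma verts_cube: "verts cube = {(0,0), (1,0), (2,0), (3,0), (0,1), (1,1), (2,1), (3,1)}"
  using bipartition_C4_P2 unfolding bipartition_def by blast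

lemma cube_colours_ge_4:
  assumes "bipartition G even_part odd_part" "finite (edges G)" "edges cube \<subseteq> edges G"
    and "local_antimagic G f" "\<not> 4 dvd \<Sum>{1..card (edges G)}"
  shows "card (vertex_sum G f ` verts G) \<ge> 4"
proof (rule local_antimagic_colours_ge_4[OF assms(1,2) _ _ _ assms(4)])
  show "bij_betw antipode even_part odd_part"
    by (auto simp: bij_betw_def antipode_def)
  have card: "card even_part = 4"
    by simp
  show "4 \<le> card even_part"
    by simp
  show "\<not> card even_part dvd \<Sum>{1..card (edges G)}"
    unfolding card by (rule assms(5))
  fix a b assume "a \<in> even_part" "b \<in> even_part" "a \<noteq> b"
  then have "{a, antipode b} \<in> edges cube"
    unfolding edges_C4_P2
    by (elim insertE emptyE) (simp_all add: antipode_def doubleton_eq_iff)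
  then show "{a, antipode b} \<in> edges G"
    using assms(3) by blast
qed

text \<open>The vertex sums are 17, 18, 21 and 22, each on one antipodal pair.\<close>

definition cube_order :: "((nat \<times> nat) \<times> (nat \<times> nat)) list" where
  "cube_order =
    [((3,0),(0,0)), ((0,1),(1,1)), ((2,0),(2,1)), ((3,1),(0,1)), ((1,0),(2,0)),
     ((3,0),(3,1)), ((1,0),(1,1)), ((1,1),(2,1)), ((0,0),(1,0)), ((2,0),(3,0)),
     ((2,1),(3,1)), ((0,0),(0,1))]"

text \<open>For \<open>k\<close>, \<open>l\<close>, \<open>m\<close>, \<open>n\<close> in cyclic
  order around the 4-cycle. The ninth entry is the added diagonal. The sums are 34 at
  \<open>(k,0)\<close>, 16 at \<open>(k,1)\<close>, 25 at \<open>(l,0)\<close>,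
  \<open>(n,0)\<close>, \<open>(m,1)\<close>, and 19 at the other three vertices.\<close>

definition cube_diagonal_order :: "nat \<Rightarrow> nat \<Rightarrow> nat \<Rightarrow> nat \<Rightarrow> ((nat \<times> nat) \<times> (nat \<times> nat)) list" where
  "cube_diagonal_order k l m n =
    [((k,0),(k,1)), ((m,1),(n,1)), ((k,1),(l,1)), ((l,0),(m,0)), ((n,0),(n,1)),
     ((l,1),(m,1)), ((m,0),(n,0)), ((m,0),(m,1)), ((k,0),(m,1)), ((l,0),(l,1)),
     ((k,0),(l,0)), ((n,1),(k,1)), ((n,0),(k,0))]"

lemma chi_la_cube: "chi_la cube = 4"
proof (rule chi_la_eqI)
  define es where "es = map (\<lambda>(u, v). {u, v}) cube_order"
  note es = es_def[unfolded cube_order_def, simplified]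
  have distinct: "distinct es"
    by (simp add: es doubleton_eq_iff)
  have edges: "edges cube = set es"
    unfolding edges_C4_P2 es by (simp add: insert_commute)
  have card: "card (edges cube) = 12"
    using distinct_card[OF distinct] by (simp add: edges es)
  show "4 \<le> card (vertex_sum cube f ` verts cube)" if "local_antimagic cube f" for f
  proof (rule cube_colours_ge_4[OF bipartition_C4_P2 _ subset_refl that])
    show "finite (edges cube)"
      by (simp add: edges)
    show "\<not> 4 dvd \<Sum>{1..card (edges cube)}"
      by (simp add: card Sum_Icc_nat)
  qed
  note sums = vertex_sum_order_label[OF distinct edges]
  show "local_antimagic cube (order_label es)"
    using distinct edges es_def
  proof (rule local_antimagic_order_label)
    show "\<forall>(u, v)\<in>set cube_order.
        vertex_sum cube (order_label es) u \<noteq> vertex_sum cube (order_label es) v"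
      unfolding cube_order_def list.set ball_simps prod.case sums by (simp add: es)
  qed
  show "card (vertex_sum cube (order_label es) ` verts cube) = 4"
    unfolding verts_cube image_insert image_empty sums by (simp add: es card_insert_if)
qed

text \<open>The cube is connected, so its two parts are forced up to swapping, and non-adjacent
  vertices from different parts are antipodes. These lie on different layers, so the pair can be
  written with layer 0 first.\<close>

lemma bipartition_cube_non_edge:
  assumes bip: "bipartition cube A B" and ab: "a \<in> A" "b \<in> B" and non_edge: "{a, b} \<notin> edges cube"
  obtains k l m n :: nat where
    "(k, l, m, n) \<in> {(0,1,2,3), (1,2,3,0), (2,3,0,1), (3,0,1,2)}" "{a, b} = {(k, 0), (m, 1)}"
proof -
  have opp: "u \<in> A \<longleftrightarrow> v \<notin> A" if "{u, v} \<in> edges cube" for u v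
    using bip that unfolding bipartition_def by (fastforce simp: doubleton_eq_iff)
  \<comment> \<open>The seven edges of a spanning tree: membership in \<open>A\<close> of one vertex
    decides it for all.\<close>
  have adj: "(0,0) \<in> A \<longleftrightarrow> (1,0) \<notin> A" "(1,0) \<in> A \<longleftrightarrow> (2,0) \<notin> A" "(2,0) \<in> A \<longleftrightarrow> (3,0) \<notin> A"
    "(0,1) \<in> A \<longleftrightarrow> (1,1) \<notin> A" "(1,1) \<in> A \<longleftrightarrow> (2,1) \<notin> A" "(2,1) \<in> A \<longleftrightarrow> (3,1) \<notin> A"
    "(0,0) \<in> A \<longleftrightarrow> (0,1) \<notin> A"
    by (rule opp; simp add: edges_C4_P2)+
  have "a \<in> verts cube" "b \<in> verts cube" "b \<notin> A"
    using bip ab unfolding bipartition_def by blast+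
  then have "{a, b} \<in> {{(0,0), (2,1)}, {(1,0), (3,1)}, {(2,0), (0,1)}, {(3,0), (1,1)}}"
    using ab(1) non_edge adj unfolding verts_cube edges_C4_P2
    by (elim insertE emptyE; simp add: doubleton_eq_iff; blast)
  then consider "{a, b} = {(0,0), (2,1)}" | "{a, b} = {(1,0), (3,1)}"
    | "{a, b} = {(2,0), (0,1)}" | "{a, b} = {(3,0), (1,1)}"
    by blast
  then show thesis
    by cases (rule that; simp)+
qed

lemma chi_la_cube_diagonal:
  fixes k l m n :: nat
  assumes rot: "(k, l, m, n) \<in> {(0,1,2,3), (1,2,3,0), (2,3,0,1), (3,0,1,2)}"
  shows "chi_la (add_edge cube {(k, 0), (m, 1)}) = 4"
proof -
  define G where "G = add_edge cube {(k, 0), (m, 1)}"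
  define es where "es = map (\<lambda>(u, v). {u, v}) (cube_diagonal_order k l m n)"
  note es = es_def[unfolded cube_diagonal_order_def, simplified]
  \<comment> \<open>With pairwise distinctness the labeling is evaluated once, for symbolic indices,
    instead of once per rotation.\<close>
  have neq: "k \<noteq> l" "k \<noteq> m" "k \<noteq> n" "l \<noteq> m" "l \<noteq> n" "m \<noteq> n"
    using rot by auto
  note neqs = neq neq[symmetric]
  have verts: "verts G = {(k,0), (l,0), (m,0), (n,0), (k,1), (l,1), (m,1), (n,1)}"
    unfolding G_def add_edge_def fst_conv verts_cube
    using rot by (elim insertE emptyE) (simp_all add: insert_commute)
  have distinct: "distinct es"
    by (simp add: es doubleton_eq_iff neqs)
  have edges: "edges G = set es"
    unfolding G_def add_edge_def snd_conv edges_C4_P2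
    using rot by (elim insertE emptyE) (simp_all add: es insert_commute)
  have card: "card (edges G) = 13"
    using distinct_card[OF distinct] by (simp add: edges es)
  \<comment> \<open>For odd \<open>k\<close> the vertex \<open>(k, 0)\<close> lies in
    \<open>odd_part\<close>, hence the unordered pair.\<close>
  have "\<exists>a\<in>even_part. \<exists>b\<in>odd_part. {(k, 0), (m, 1)} = {a, b}"
    using rot by (elim insertE emptyE) (simp_all add: doubleton_eq_iff)
  then have bip: "bipartition G even_part odd_part"
    unfolding G_def by (elim bexE) (rule bipartition_add_edge[OF bipartition_C4_P2])
  note sums = vertex_sum_order_label[OF distinct edges]
  have "chi_la G = 4"
  proof (rule chi_la_eqI)
    show "4 \<le> card (vertex_sum G f ` verts G)" if "local_antimagic G f" for f
    proof (rule cube_colours_ge_4[OF bip _ _ that])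
      show "finite (edges G)"
        by (simp add: edges)
      show "edges cube \<subseteq> edges G"
        by (auto simp: G_def add_edge_def)
      show "\<not> 4 dvd \<Sum>{1..card (edges G)}"
        by (simp add: card Sum_Icc_nat)
    qed
    show "local_antimagic G (order_label es)"
      using distinct edges es_def
    proof (rule local_antimagic_order_label)
      show "\<forall>(u, v)\<in>set (cube_diagonal_order k l m n).
          vertex_sum G (order_label es) u \<noteq> vertex_sum G (order_label es) v"
        unfolding cube_diagonal_order_def list.set ball_simps prod.case sums
        by (simp add: es neqs)
    qed
    show "card (vertex_sum G (order_label es) ` verts G) = 4"
      unfolding verts image_insert image_empty sums by (simp add: es neqs card_insert_if)
  qed
  then show ?thesis
    by (simp add: G_def)
qed

theorem theorem2p3:
  shows "chi_la (cartesian_product (cycle_graph 4) (path_graph 2)) = 4 \<and>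
    (\<forall>A B a b.
       bipartition (cartesian_product (cycle_graph 4) (path_graph 2)) A B \<and>
       a \<in> A \<and> b \<in> B \<and>
       {a, b} \<notin> edges (cartesian_product (cycle_graph 4) (path_graph 2)) \<longrightarrow>
       chi_la (add_edge (cartesian_product (cycle_graph 4) (path_graph 2)) {a, b}) = 4)"
proof (intro conjI allI impI)
  show "chi_la cube = 4"
    by (rule chi_la_cube)
  fix A B a b
  assume "bipartition cube A B \<and> a \<in> A \<and> b \<in> B \<and> {a, b} \<notin> edges cube"
  then obtain k l m n :: nat where
    rot: "(k, l, m, n) \<in> {(0,1,2,3), (1,2,3,0), (2,3,0,1), (3,0,1,2)}"
    and ab: "{a, b} = {(k, 0), (m, 1)}"
    using bipartition_cube_non_edge by metis
  show "chi_la (add_edge cube {a, b}) = 4"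
    unfolding ab by (rule chi_la_cube_diagonal[OF rot])
qed

end
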